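(* Let $b>0$ and $c\in\mathbf{R}$. Let $w=w(x,t)$ be the bounded solution of the heat equation $$w_t-w_{xx}=0\quad\text{in }(-\infty,0)\times(0,\infty)$$ with the Robin boundary condition $$w_x(0,t)+b\,w(0,t)=0\quad\text{for }t>0,$$ and initial data $w(x,0)=-c$. Then the boundary value $\xi(t)=w(0,t)$ solves $$\int_0^t f^0_{1/2}(t-s)\,\xi_s(s)\,ds=-b\,\xi(t),\qquad t>0.$$ In other words, $\partial_t^{1/2}\xi=-b\xi$, where $\partial_t^{1/2}$ is the Caputo half derivative.
   Context: Here $f^0_{1/2}(t)=t^{-1/2}/\Gamma(1/2)$ for $t>0$, and $\xi_s$ denotes the derivative of $\xi$. The Caputo half derivative is $\partial_t^{1/2}\xi(t)=\int_0^t f^0_{1/2}(t-s)\xi_s(s)\,ds$. *)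

theory Defs
  imports "HOL-Analysis.Analysis"
begin

definition f0_half :: "real \<Rightarrow> real" where
  "f0_half t = t powr (- 1 / 2) / Gamma (1 / 2)"

text \<open>
  The integrand of the Caputo half derivative is singular at both ends in general, so the open
  interval is used. When the integrand is not integrable, the Lebesgue integral has the default
  value 0; \<^term>\<open>caputo_half_exists\<close> expresses that the integral is meaningful.
\<close>

definition caputo_half_exists :: "(real \<Rightarrow> real) \<Rightarrow> real \<Rightarrow> bool" where
  "caputo_half_exists \<xi> t \<longleftrightarrow>
     (\<forall>s\<in>{0<..<t}. \<xi> differentiable (at s)) \<and>
     set_integrable lborel {0<..<t} (\<lambda>s. f0_half (t - s) * deriv \<xi> s)"

definition caputo_half :: "(real \<Rightarrow> real) \<Rightarrow> real \<Rightarrow> real" where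
  "caputo_half \<xi> t = (LINT s:{0<..<t}|lborel. f0_half (t - s) * deriv \<xi> s)"

text \<open>
  Bounded classical solutions \<open>w x t\<close> of the heat equation on the left half line. Here
  \<open>w\<^sub>x\<close>, \<open>w\<^sub>x\<^sub>x\<close> and \<open>w\<^sub>t\<close> are the pointwise partial derivatives; at \<open>x = 0\<close> the derivative in
  \<open>x\<close> is one-sided. The solution takes its initial and boundary values continuously.
  Continuity is not demanded at the corner \<open>x = t = 0\<close>, where the initial line meets the
  lateral boundary.
\<close>

definition bounded_robin_heat_solution :: "real \<Rightarrow> real \<Rightarrow> (real \<Rightarrow> real \<Rightarrow> real) \<Rightarrow> bool" where
  "bounded_robin_heat_solution b c w \<longleftrightarrow>
     bounded ((\<lambda>(x, t). w x t) ` ({..<0} \<times> {0<..})) \<and>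
     continuous_on ({..0} \<times> {0..} - {(0, 0)}) (\<lambda>(x, t). w x t) \<and>
     (\<exists>wx wxx wt :: real \<Rightarrow> real \<Rightarrow> real.
        (\<forall>x\<le>0. \<forall>t>0. ((\<lambda>y. w y t) has_real_derivative wx x t) (at x within {..0})) \<and>
        (\<forall>x<0. \<forall>t>0. ((\<lambda>y. wx y t) has_real_derivative wxx x t) (at x)) \<and>
        (\<forall>x<0. \<forall>t>0. ((\<lambda>s. w x s) has_real_derivative wt x t) (at t)) \<and>
        (\<forall>x<0. \<forall>t>0. wt x t - wxx x t = 0) \<and>
        (\<forall>t>0. wx 0 t + b * w 0 t = 0)) \<and>
     (\<forall>x<0. w x 0 = - c)"

end

theory Submission
  imports Defs "HOL-Probability.Distributions"
begin

text \<open>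
  The problem has the explicit solution
  \<open>-c (erf (-x / (2 sqrt t)) + exp (b\<^sup>2 t - b x) erfc (b sqrt t - x / (2 sqrt t)))\<close>. A maximum
  principle, with a barrier that absorbs the lack of information at the corner, shows that every
  bounded solution agrees with it. Hence \<open>\<xi> = -c h\<close> with \<open>h t = exp (b\<^sup>2 t) erfc (b sqrt t)\<close>.
  If \<open>I\<close> denotes convolution with \<open>f0_half\<close>, then \<open>h = exp (b\<^sup>2 t) - b I (exp (b\<^sup>2 t))\<close> and
  \<open>h' = b\<^sup>2 h - b f0_half\<close>, and the semigroup property \<open>I f0_half = 1\<close> turns \<open>I h'\<close> into \<open>-b h\<close>.
\<close>

section \<open>Comparison for the Robin problem\<close>

text \<open>A positive maximum over the compact rectangle can lie neither on the bottom nor on the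
  left side. On x = 0 the negative slope would make \<open>D\<close> larger just to the left.
  Elsewhere the strict differential inequality excludes it. The condition \<open>bc\<close> is
  restricted to positive boundary values because the Robin condition with b > 0 controls the sign of
  the slope only there.\<close>

lemma robin_maximum_principle:
  fixes D Dx Dxx Dt :: "real \<Rightarrow> real \<Rightarrow> real"
  assumes cont: "continuous_on ({a..0} \<times> {\<epsilon>..T}) (\<lambda>(x, t). D x t)"
    and dx: "\<And>x t. a < x \<Longrightarrow> x \<le> 0 \<Longrightarrow> \<epsilon> < t \<Longrightarrow> t \<le> T \<Longrightarrow>
              ((\<lambda>y. D y t) has_real_derivative Dx x t) (at x within {..0})"
    and dxx: "\<And>x t. a < x \<Longrightarrow> x < 0 \<Longrightarrow> \<epsilon> < t \<Longrightarrow> t \<le> T \<Longrightarrow>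
              ((\<lambda>y. Dx y t) has_real_derivative Dxx x t) (at x)"
    and dt: "\<And>x t. a < x \<Longrightarrow> x < 0 \<Longrightarrow> \<epsilon> < t \<Longrightarrow> t \<le> T \<Longrightarrow>
              ((\<lambda>s. D x s) has_real_derivative Dt x t) (at t)"
    and sub: "\<And>x t. a < x \<Longrightarrow> x < 0 \<Longrightarrow> \<epsilon> < t \<Longrightarrow> t \<le> T \<Longrightarrow> Dt x t < Dxx x t"
    and bc: "\<And>t. \<epsilon> < t \<Longrightarrow> t \<le> T \<Longrightarrow> D 0 t > 0 \<Longrightarrow> Dx 0 t < 0"
    and init: "\<And>x. a \<le> x \<Longrightarrow> x \<le> 0 \<Longrightarrow> D x \<epsilon> \<le> 0"
    and left: "\<And>t. \<epsilon> \<le> t \<Longrightarrow> t \<le> T \<Longrightarrow> D a t \<le> 0"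
    and xt: "a \<le> x" "x \<le> 0" "\<epsilon> \<le> t" "t \<le> T"
  shows "D x t \<le> 0"
proof (rule ccontr)
  assume "\<not> D x t \<le> 0"
  hence pos: "D x t > 0" by simp
  have "compact ({a..0} \<times> {\<epsilon>..T})" by (simp add: compact_Times)
  moreover have "{a..0} \<times> {\<epsilon>..T} \<noteq> {}" using xt by auto
  ultimately obtain p where p: "p \<in> {a..0} \<times> {\<epsilon>..T}"
    and pmax: "\<forall>q\<in>{a..0} \<times> {\<epsilon>..T}. (\<lambda>(x, t). D x t) q \<le> (\<lambda>(x, t). D x t) p"
    using continuous_attains_sup[OF _ _ cont] by blast
  obtain y s where ps: "p = (y, s)" by (cases p)
  have mx: "D u r \<le> D y s" if "a \<le> u" "u \<le> 0" "\<epsilon> \<le> r" "r \<le> T" for u r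
    using bspec[OF pmax, of "(u, r)"] that by (simp add: ps)
  have Dpos: "D y s > 0" using mx[OF xt] pos by linarith
  have ys: "a \<le> y" "y \<le> 0" "\<epsilon> \<le> s" "s \<le> T" using p ps by auto
  have "y \<noteq> a" using left[of s] Dpos ys by auto
  hence ya: "a < y" using ys by simp
  have "s \<noteq> \<epsilon>" using init[of y] Dpos ys by auto
  hence se: "\<epsilon> < s" using ys by simp
  show False
  proof (cases "y = 0")
    case True
    have "Dx 0 s < 0" using bc[OF se] ys Dpos True by simp
    with dx[of 0 s] obtain d where d: "d > 0" "\<And>h. 0 < h \<Longrightarrow> 0 - h \<in> {..0} \<Longrightarrow> h < d \<Longrightarrow> D 0 s < D (0 - h) s"
      using has_real_derivative_neg_dec_left[of "\<lambda>y. D y s" "Dx 0 s" 0 "{..0}"] ya se ys True by auto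
    \<comment> \<open>The first bound keeps the step below \<open>d\<close>, the second keeps
      \<open>0 - h\<close> in the rectangle.\<close>
    define h where "h = min (d / 2) (- a)"
    have "D 0 s < D (0 - h) s" by (rule d(2)) (use d(1) ya True in \<open>auto simp: h_def min_def\<close>)
    moreover have "D (0 - h) s \<le> D y s" by (rule mx) (use d(1) ya True ys in \<open>auto simp: h_def min_def\<close>)
    ultimately show False using True by simp
  next
    case False
    hence y0: "y < 0" using ys by simp
    have der: "((\<lambda>u. D u s) has_real_derivative Dx u s) (at u)" if "a < u" "u < 0" for u
    proof -
      have "at u within {..0} = at u"
        by (rule at_within_interior) (use that in \<open>auto simp: interior_real_atMost\<close>)
      with dx[of u s] that se ys show ?thesis by simp
    qed
    \<comment> \<open>Only earlier times are compared, so the maximum may also lie on the top edge,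
      where \<open>s = T\<close>.\<close>
    have "Dt y s \<ge> 0"
    proof (rule ccontr)
      assume "\<not> Dt y s \<ge> 0"
      with dt[of y s] obtain d where d: "d > 0" "\<And>h. 0 < h \<Longrightarrow> h < d \<Longrightarrow> D y s < D y (s - h)"
        using has_real_derivative_neg_dec_left[of "D y" "Dt y s" s UNIV] ya y0 se ys by auto
      define h where "h = min (d / 2) (s - \<epsilon>)"
      have "D y s < D y (s - h)" by (rule d(2)) (use d(1) se in \<open>auto simp: h_def min_def\<close>)
      moreover have "D y (s - h) \<le> D y s" by (rule mx) (use d(1) se ys in \<open>auto simp: h_def min_def\<close>)
      ultimately show False by simp
    qed
    \<comment> \<open>A critical point with positive second derivative: \<open>Dx\<close> vanishes
      at \<open>y\<close> and is positive just to its right, so by the mean value theorem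
      \<open>D\<close> exceeds its maximum there.\<close>
    with sub[of y s] have "Dxx y s > 0" using ya y0 se ys by auto
    moreover have Dx0: "Dx y s = 0"
    proof (rule DERIV_local_max[OF der])
      show "0 < min (y - a) (- y)" using ya y0 by simp
      show "\<forall>u. \<bar>y - u\<bar> < min (y - a) (- y) \<longrightarrow> D u s \<le> D y s"
        by (auto intro!: mx simp: ys)
    qed (use ya y0 in auto)
    ultimately obtain d where d: "d > 0" "\<And>h. 0 < h \<Longrightarrow> h < d \<Longrightarrow> Dx (y + h) s > 0"
      using has_real_derivative_pos_inc_right[of "\<lambda>y. Dx y s" "Dxx y s" y UNIV] dxx[of y s] ya y0 se ys
      by auto
    define h where "h = min (d / 2) (- y / 2)"
    have h: "0 < h" "h < d" "y + h < 0" using d(1) y0 by (auto simp: h_def min_def field_simps)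
    have "\<exists>z>y. z < y + h \<and> D (y + h) s - D y s = (y + h - y) * Dx z s"
      by (rule MVT2) (use h ya in \<open>auto intro!: der\<close>)
    then obtain z where z: "z > y" "z < y + h" "D (y + h) s - D y s = h * Dx z s" by auto
    have "Dx z s > 0" using d(2)[of "z - y"] z h by simp
    with h have "h * Dx z s > 0" by simp
    with z have "D (y + h) s > D y s" by simp
    moreover have "D (y + h) s \<le> D y s" by (rule mx) (use h ya ys in auto)
    ultimately show False by simp
  qed
qed

section \<open>A Gaussian barrier for the corner\<close>

text \<open>This is \<open>2 * s * sqrt pi\<close> times the heat kernel started at the origin at
  time \<open>- s\<^sup>2\<close>. The time shift removes the singularity at t = 0, and the factor
  \<open>s\<close> makes its size comparable to 1 on the parabolic box of side \<open>s\<close> in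
  space and \<open>s\<^sup>2\<close> in time. It is even in x, so it has zero slope at the
  boundary.\<close>

definition heat_bump :: "real \<Rightarrow> real \<Rightarrow> real \<Rightarrow> real" where
  "heat_bump s x t = s / sqrt (t + s\<^sup>2) * exp (- (x\<^sup>2 / (4 * (t + s\<^sup>2))))"

definition heat_bump_x :: "real \<Rightarrow> real \<Rightarrow> real \<Rightarrow> real" where
  "heat_bump_x s x t = - (x / (2 * (t + s\<^sup>2))) * heat_bump s x t"

definition heat_bump_t :: "real \<Rightarrow> real \<Rightarrow> real \<Rightarrow> real" where
  "heat_bump_t s x t = (x\<^sup>2 / (4 * (t + s\<^sup>2)\<^sup>2) - 1 / (2 * (t + s\<^sup>2))) * heat_bump s x t"

lemma has_real_derivative_heat_bump_x:
  "((\<lambda>x. heat_bump s x t) has_real_derivative heat_bump_x s x t) (at x within A)"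
proof -
  have "((\<lambda>x. x\<^sup>2) has_real_derivative 2 * x) (at x within A)"
    by (auto intro!: derivative_eq_intros)
  from DERIV_cmult[OF DERIV_chain2[OF DERIV_exp DERIV_minus[OF DERIV_cdivide[OF this]]]]
  have "((\<lambda>x. s / sqrt k * exp (- (x\<^sup>2 / (4 * k)))) has_real_derivative
      - (x / (2 * k)) * (s / sqrt k * exp (- (x\<^sup>2 / (4 * k))))) (at x within A)" for k
    by (rule DERIV_cong) (simp add: ac_simps)
  thus ?thesis unfolding heat_bump_def heat_bump_x_def .
qed

text \<open>That \<open>heat_bump_t\<close> appears here as the second space derivative is the heat
  equation for the bump.\<close>

lemma has_real_derivative_heat_bump_xx:
  "((\<lambda>x. heat_bump_x s x t) has_real_derivative heat_bump_t s x t) (at x within A)"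
proof -
  have "((\<lambda>x. - (x / (2 * (t + s\<^sup>2)))) has_real_derivative - (1 / (2 * (t + s\<^sup>2)))) (at x within A)"
    by (intro DERIV_minus DERIV_cdivide DERIV_ident)
  from DERIV_mult[OF this has_real_derivative_heat_bump_x] show ?thesis
    unfolding heat_bump_x_def heat_bump_t_def
    by (rule DERIV_cong) (simp add: algebra_simps power2_eq_square)
qed

lemma has_real_derivative_heat_bump_t:
  assumes "t > 0"
  shows "((\<lambda>t. heat_bump s x t) has_real_derivative heat_bump_t s x t) (at t)"
proof -
  define r where "r = t + s\<^sup>2"
  have r: "r > 0" using assms by (simp add: r_def add_pos_nonneg)
  have 0: "((\<lambda>t. t + s\<^sup>2) has_real_derivative 1) (at t)"
    by (auto intro!: derivative_eq_intros)
  have 1: "((\<lambda>r. s / sqrt r * exp (- (x\<^sup>2 / (4 * r)))) has_real_derivative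
     - (1 / (2 * r)) * (s / sqrt r) * exp (- (x\<^sup>2 / (4 * r))) +
     s / sqrt r * (exp (- (x\<^sup>2 / (4 * r))) * (x\<^sup>2 / (4 * r\<^sup>2)))) (at r)"
  proof (rule DERIV_cong[OF DERIV_mult])
    show "((\<lambda>r. s / sqrt r) has_real_derivative - (1 / (2 * r)) * (s / sqrt r)) (at r)"
      by (rule DERIV_cong[OF DERIV_divide[OF DERIV_const DERIV_real_sqrt[OF r]]])
        (use r in \<open>simp_all add: divide_simps\<close>)
    have "((\<lambda>r. - (x\<^sup>2 / (4 * r))) has_real_derivative x\<^sup>2 / (4 * r\<^sup>2)) (at r)"
      by (rule DERIV_cong[OF DERIV_minus[OF DERIV_divide[OF DERIV_const DERIV_cmult[OF DERIV_ident]]]])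
        (use r in \<open>simp_all add: divide_simps power2_eq_square\<close>)
    then show "((\<lambda>r. exp (- (x\<^sup>2 / (4 * r)))) has_real_derivative
       exp (- (x\<^sup>2 / (4 * r))) * (x\<^sup>2 / (4 * r\<^sup>2))) (at r)"
      by (rule DERIV_fun_exp)
  qed (simp add: algebra_simps)
  from DERIV_chain2[OF this[unfolded r_def] 0] show ?thesis
    unfolding heat_bump_def heat_bump_t_def
    by (rule DERIV_cong) (simp add: algebra_simps)
qed

lemma heat_bump_nonneg: "0 \<le> s \<Longrightarrow> 0 \<le> t \<Longrightarrow> 0 \<le> heat_bump s x t"
  by (simp add: heat_bump_def)

lemma heat_bump_le:
  assumes "0 < s" "0 < t"
  shows "heat_bump s x t \<le> s / sqrt t"
proof -
  have "heat_bump s x t \<le> s / sqrt (t + s\<^sup>2) * 1"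
    unfolding heat_bump_def by (rule mult_left_mono) (use assms in auto)
  also have "\<dots> \<le> s / sqrt t"
    using assms by (simp add: frac_le)
  finally show ?thesis .
qed

text \<open>Each of the two factors is at least 1/2: the square root is at most
  \<open>2 * s\<close>, and the exponent is at least -1/4.\<close>

lemma heat_bump_ge_quarter:
  assumes "0 < s" "0 \<le> t" "t \<le> s\<^sup>2" "\<bar>x\<bar> \<le> s"
  shows "1 / 4 \<le> heat_bump s x t"
proof -
  have "sqrt (t + s\<^sup>2) \<le> sqrt ((2 * s)\<^sup>2)"
    using assms by (intro real_sqrt_le_mono) (simp add: power_mult_distrib)
  hence "sqrt (t + s\<^sup>2) \<le> 2 * s" using assms by (subst (asm) real_sqrt_abs) simp
  moreover have "0 < sqrt (t + s\<^sup>2)" using assms by (simp add: add_nonneg_pos)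
  ultimately have 1: "1 / 2 \<le> s / sqrt (t + s\<^sup>2)"
    by (simp add: field_simps)
  have "x\<^sup>2 \<le> s\<^sup>2" using assms by (simp add: abs_le_square_iff[symmetric])
  hence "x\<^sup>2 / (4 * (t + s\<^sup>2)) \<le> 1 / 4"
    using assms by (simp add: field_simps add_nonneg_pos)
  moreover have "1 + - (x\<^sup>2 / (4 * (t + s\<^sup>2))) \<le> exp (- (x\<^sup>2 / (4 * (t + s\<^sup>2))))"
    by (rule exp_ge_add_one_self)
  ultimately have 2: "1 / 2 \<le> exp (- (x\<^sup>2 / (4 * (t + s\<^sup>2))))" by linarith
  from mult_mono[OF 1 2] assms show ?thesis by (simp add: heat_bump_def)
qed

text \<open>The function is compared with a bump that is at least \<open>M\<close> near the corner, where nothing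
  is known about the initial values, plus small quadratic growth. The bump has mass of order
  \<open>s\<close>, so it disappears as \<open>s\<close> tends to \<open>0\<close>.\<close>
lemma robin_comparison:
  fixes v vx vxx :: "real \<Rightarrow> real \<Rightarrow> real"
  assumes b: "b > 0"
    and cont: "continuous_on ({..0} \<times> {0<..}) (\<lambda>(x, t). v x t)"
    and bounded: "\<And>x t. x \<le> 0 \<Longrightarrow> t > 0 \<Longrightarrow> v x t \<le> M"
    and vx: "\<And>x t. x \<le> 0 \<Longrightarrow> t > 0 \<Longrightarrow> ((\<lambda>y. v y t) has_real_derivative vx x t) (at x within {..0})"
    and vxx: "\<And>x t. x < 0 \<Longrightarrow> t > 0 \<Longrightarrow> ((\<lambda>y. vx y t) has_real_derivative vxx x t) (at x)"
    and vt: "\<And>x t. x < 0 \<Longrightarrow> t > 0 \<Longrightarrow> ((\<lambda>s. v x s) has_real_derivative vxx x t) (at t)"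
    and bc: "\<And>t. t > 0 \<Longrightarrow> vx 0 t + b * v 0 t = 0"
    and init: "\<And>R \<delta> \<eta>. 0 < \<delta> \<Longrightarrow> 0 < \<eta> \<Longrightarrow> \<exists>\<epsilon>>0. \<forall>t\<in>{0<..\<epsilon>}. \<forall>x\<in>{-R..-\<delta>}. v x t \<le> \<eta>"
    and xt: "x \<le> 0" "t > 0"
  shows "v x t \<le> 0"
proof -
  define N where "N = max M 1"
  have N: "N \<ge> 1" "\<And>x t. x \<le> 0 \<Longrightarrow> t > 0 \<Longrightarrow> v x t \<le> N"
    using bounded by (auto simp: N_def max.coboundedI1)
  \<comment> \<open>\<open>s * C\<close> will bound the barrier at the given point. Since
    \<open>C\<close> does not depend on \<open>s\<close>, letting \<open>s\<close> tend to 0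
    finishes the proof.\<close>
  define C where "C = 1 + x\<^sup>2 + 3 * t + 4 * N / sqrt t"
  have C: "C > 0"
    using N(1) xt by (auto simp: C_def intro!: add_pos_nonneg)
  have key: "v x t \<le> s * C" if s: "s > 0" for s
  proof -
    \<comment> \<open>The polynomial has time derivative \<open>3 * s\<close> but second space
      derivative only \<open>2 * s\<close>, so \<open>S\<close> is a strict supersolution. The
      factor \<open>4 * N\<close> raises the lower bound 1/4 of the bump to
      \<open>N\<close>.\<close>
    define S where "S x t = s * (1 + x\<^sup>2 + 3 * t) + 4 * N * heat_bump s x t" for x t
    \<comment> \<open>Large enough that the quadratic term exceeds \<open>N\<close> on the left side
      x = -R and that the given point lies in the rectangle. The summand 1 turns
      \<open>N / s \<le> R\<close> into a bound by the square of \<open>R\<close>.\<close>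
    define R where "R = \<bar>x\<bar> + 1 + N / s"
    have Ns: "0 \<le> N / s" using N s by simp
    have R: "R \<ge> 1" "- R \<le> x" "N / s \<le> R" using Ns by (auto simp: R_def)
    have "N / s \<le> R * R" using mult_mono[OF R(3) R(1)] R(1) Ns by simp
    hence RN: "N \<le> s * R\<^sup>2" using s by (simp add: field_simps power2_eq_square)
    obtain \<epsilon>0 where e0: "\<epsilon>0 > 0" "\<And>t x. 0 < t \<Longrightarrow> t \<le> \<epsilon>0 \<Longrightarrow> -R \<le> x \<Longrightarrow> x \<le> -s \<Longrightarrow> v x t \<le> s"
      using init[OF s s, of R] by force
    \<comment> \<open>The starting time is positive and small enough for the initial estimate to the
      left of \<open>- s\<close>, and for the lower bound of the bump between \<open>- s\<close> and
      0.\<close>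
    define \<epsilon> where "\<epsilon> = Min {\<epsilon>0, s\<^sup>2, t}"
    have e: "\<epsilon> > 0" "\<epsilon> \<le> \<epsilon>0" "\<epsilon> \<le> s\<^sup>2" "\<epsilon> \<le> t"
      using e0(1) s xt by (auto simp: \<epsilon>_def)
    have Sge: "s * (1 + y\<^sup>2) \<le> S y r" if "r > 0" for y r
      unfolding S_def using heat_bump_nonneg[of s r y] N that s by (simp add: algebra_simps)
    have Sge': "4 * N * heat_bump s y r \<le> S y r" if "r > 0" for y r
      unfolding S_def using that s by (simp add: add_nonneg_nonneg)
    have "v x t - S x t \<le> 0"
    proof (rule robin_maximum_principle[where D = "\<lambda>x t. v x t - S x t" and a = "-R" and \<epsilon> = \<epsilon> and T = t
        and Dx = "\<lambda>x t. vx x t - (s * (2 * x) + 4 * N * heat_bump_x s x t)"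
        and Dxx = "\<lambda>x t. vxx x t - (s * 2 + 4 * N * heat_bump_t s x t)"
        and Dt = "\<lambda>x t. vxx x t - (s * 3 + 4 * N * heat_bump_t s x t)"])
      have "continuous_on ({- R..0} \<times> {\<epsilon>..t}) (\<lambda>(x, t). v x t)"
        by (rule continuous_on_subset[OF cont]) (use e in auto)
      moreover have "continuous_on ({- R..0} \<times> {\<epsilon>..t}) (\<lambda>(x, t). S x t)"
        unfolding S_def heat_bump_def case_prod_unfold
        by (intro continuous_intros) (use e in \<open>auto simp: add_pos_nonneg less_imp_neq[symmetric]\<close>)
      ultimately show "continuous_on ({- R..0} \<times> {\<epsilon>..t}) (\<lambda>(x, t). v x t - S x t)"
        unfolding case_prod_unfold by (rule continuous_on_diff)
    next
      fix y r assume *: "- R < y" "y \<le> 0" "\<epsilon> < r" "r \<le> t"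
      show "((\<lambda>y. v y r - S y r) has_real_derivative vx y r - (s * (2 * y) + 4 * N * heat_bump_x s y r)) (at y within {..0})"
        unfolding S_def
        by (rule derivative_eq_intros has_real_derivative_heat_bump_x vx refl | use * e in simp)+
    next
      fix y r assume *: "- R < y" "y < 0" "\<epsilon> < r" "r \<le> t"
      show "((\<lambda>y. vx y r - (s * (2 * y) + 4 * N * heat_bump_x s y r)) has_real_derivative
          vxx y r - (s * 2 + 4 * N * heat_bump_t s y r)) (at y)"
        by (rule derivative_eq_intros has_real_derivative_heat_bump_xx vxx refl | use * e in simp)+
      show "((\<lambda>r. v y r - S y r) has_real_derivative
          vxx y r - (s * 3 + 4 * N * heat_bump_t s y r)) (at r)"
        unfolding S_def
        by (rule derivative_eq_intros has_real_derivative_heat_bump_t vt refl | use * e in simp)+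
      show "vxx y r - (s * 3 + 4 * N * heat_bump_t s y r) < vxx y r - (s * 2 + 4 * N * heat_bump_t s y r)"
        using s by simp
    next
      \<comment> \<open>The slope of \<open>S\<close> vanishes at 0, and \<open>S\<close> is
        positive. So a positive difference forces \<open>v\<close> to be positive, and the Robin
        condition then makes \<open>vx\<close> negative.\<close>
      fix r assume *: "\<epsilon> < r" "r \<le> t" "v 0 r - S 0 r > 0"
      have r: "r > 0" using * e by linarith
      have "0 < s * (1 + 0\<^sup>2)" using s by simp
      also have "\<dots> \<le> S 0 r" by (rule Sge[OF r])
      finally have "v 0 r > 0" using * by simp
      hence "b * v 0 r > 0" using b by simp
      with bc[OF r] show "vx 0 r - (s * (2 * 0) + 4 * N * heat_bump_x s 0 r) < 0"
        by (simp add: heat_bump_x_def)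
    next
      fix y assume *: "- R \<le> y" "y \<le> 0"
      show "v y \<epsilon> - S y \<epsilon> \<le> 0"
      proof (cases "y \<le> - s")
        case True
        have "v y \<epsilon> \<le> s" by (rule e0(2)) (use e * True in auto)
        also have "s \<le> s * (1 + y\<^sup>2)" using s by (simp add: algebra_simps)
        also have "\<dots> \<le> S y \<epsilon>" by (rule Sge) (use e in simp)
        finally show ?thesis by simp
      next
        case False
        have "v y \<epsilon> \<le> 4 * N * (1 / 4)" using N(2)[of y \<epsilon>] * e by simp
        also have "\<dots> \<le> 4 * N * heat_bump s y \<epsilon>"
          by (intro mult_left_mono heat_bump_ge_quarter) (use e s * False N in auto)
        also have "\<dots> \<le> S y \<epsilon>" by (rule Sge') (use e in simp)
        finally show ?thesis by simp
      qed
    next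
      fix r assume *: "\<epsilon> \<le> r" "r \<le> t"
      have "v (- R) r \<le> N" by (rule N(2)) (use R * e in auto)
      also have "N \<le> s * R\<^sup>2" by (rule RN)
      also have "\<dots> \<le> s * (1 + (- R)\<^sup>2)" using s by simp
      also have "\<dots> \<le> S (- R) r" by (rule Sge) (use * e in simp)
      finally show "v (- R) r - S (- R) r \<le> 0" by simp
    qed (use xt R e in auto)
    moreover have "S x t \<le> s * C"
    proof -
      have "4 * N * heat_bump s x t \<le> 4 * N * (s / sqrt t)"
        by (intro mult_left_mono heat_bump_le) (use s xt N in auto)
      thus ?thesis by (simp add: S_def C_def algebra_simps)
    qed
    ultimately show ?thesis by simp
  qed
  show ?thesis
  proof (rule field_le_epsilon)
    fix e :: real assume "e > 0"
    with key[of "e / C"] C show "v x t \<le> 0 + e" by simp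
  qed
qed

section \<open>The explicit solution\<close>

definition erf :: "real \<Rightarrow> real" where
  "erf x = 2 / sqrt pi * (LBINT s=0..x. exp (- s\<^sup>2))"

lemma has_real_derivative_erf:
  "(erf has_real_derivative 2 / sqrt pi * exp (- x\<^sup>2)) (at x)"
proof -
  define a b where "a = - \<bar>x\<bar> - 1" and "b = \<bar>x\<bar> + 1"
  have ab: "a < x" "x < b" "a \<le> 0" "0 \<le> b" by (auto simp: a_def b_def)
  have "((\<lambda>u. LBINT s=ereal 0..ereal u. exp (- s\<^sup>2)) has_vector_derivative exp (- x\<^sup>2)) (at x within {a..b})"
    by (rule interval_integral_FTC2) (use ab in \<open>auto intro!: continuous_intros\<close>)
  moreover have "at x within {a..b} = at x"
    by (rule at_within_interior) (use ab in auto)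
  ultimately have "((\<lambda>u. LBINT s=ereal 0..ereal u. exp (- s\<^sup>2)) has_real_derivative exp (- x\<^sup>2)) (at x)"
    by (simp add: has_real_derivative_iff_has_vector_derivative)
  from DERIV_cmult[OF this, of "2 / sqrt pi"] show ?thesis
    by (simp add: erf_def[abs_def] zero_ereal_def)
qed

lemmas has_real_derivative_erf_compose [derivative_intros] = DERIV_chain2[OF has_real_derivative_erf]

lemma isCont_erf: "isCont erf x"
  by (rule DERIV_isCont[OF has_real_derivative_erf])

lemma continuous_on_erf [continuous_intros]:
  "continuous_on A f \<Longrightarrow> continuous_on A (\<lambda>x. erf (f x))"
  by (rule continuous_on_compose2[of UNIV erf])
    (auto intro: continuous_at_imp_continuous_on isCont_erf)

lemma erf_0 [simp]: "erf 0 = 0"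
  by (simp add: erf_def zero_ereal_def)

text \<open>The Gaussian integral over the half line is \<open>sqrt pi / 2\<close>, and it is the
  limit of its truncations to \<open>{..y}\<close>.\<close>

lemma tendsto_erf_at_top: "(erf \<longlongrightarrow> 1) at_top"
proof -
  let ?g = "\<lambda>s::real. indicator {0..} s *\<^sub>R exp (- s\<^sup>2)"
  have int: "integrable lborel ?g" and val: "(\<integral>s. ?g s \<partial>lborel) = sqrt pi / 2"
    using gaussian_moment_0 by (auto simp: has_bochner_integral_iff)
  have "((\<lambda>y. 2 / sqrt pi * (\<integral>s. indicator {..y} s *\<^sub>R ?g s \<partial>lborel)) \<longlongrightarrow> 2 / sqrt pi * (sqrt pi / 2)) at_top"
    by (intro tendsto_intros) (rule tendsto_integral_at_top[OF _ int, unfolded val], simp)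
  moreover have "\<forall>\<^sub>F y in at_top. 2 / sqrt pi * (\<integral>s. indicator {..y} s *\<^sub>R ?g s \<partial>lborel) = erf y"
    using eventually_ge_at_top[of 0]
  proof eventually_elim
    case (elim y)
    have "(LBINT s=ereal 0..ereal y. exp (- s\<^sup>2)) = (LBINT s:{0..y}. exp (- s\<^sup>2))"
      using elim by (simp add: interval_integral_Icc)
    also have "\<dots> = (\<integral>s. indicator {..y} s *\<^sub>R ?g s \<partial>lborel)"
      unfolding set_lebesgue_integral_def
      by (rule Bochner_Integration.integral_cong) (auto simp: indicator_def)
    finally show ?case by (simp add: erf_def zero_ereal_def)
  qed
  ultimately show ?thesis by (subst (asm) tendsto_cong) auto
qed

lemma erf_mono: "x \<le> y \<Longrightarrow> erf x \<le> erf y"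
  by (rule DERIV_nonneg_imp_nondecreasing)
    (assumption, rule exI, rule conjI, rule has_real_derivative_erf, simp)

lemma erf_le_1: "erf x \<le> 1"
  by (rule tendsto_lowerbound[OF tendsto_erf_at_top])
    (auto intro: eventually_mono[OF eventually_ge_at_top[of x] erf_mono])

text \<open>The difference of the two sides vanishes at \<open>0\<close> and at infinity, and it increases up to
  \<open>1 / sqrt pi\<close> and decreases from there on.\<close>
lemma erfc_le_exp:
  assumes "0 \<le> z"
  shows "1 - erf z \<le> exp (- z\<^sup>2)"
proof -
  define k where "k z = exp (- z\<^sup>2) - 1 + erf z" for z :: real
  have der: "(k has_real_derivative 2 * exp (- x\<^sup>2) * (1 / sqrt pi - x)) (at x)" for x
    unfolding k_def by (rule derivative_eq_intros refl | simp add: algebra_simps)+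
  have "0 \<le> k z"
  proof (cases "z \<le> 1 / sqrt pi")
    case True
    have "k 0 \<le> k z"
      by (rule DERIV_nonneg_imp_nondecreasing[OF assms])
        (rule exI, rule conjI, rule der, use True in simp)
    then show ?thesis by (simp add: k_def)
  next
    case False
    have "((\<lambda>x::real. exp (- x\<^sup>2)) \<longlongrightarrow> 0) at_top"
      by (rule filterlim_compose[OF exp_at_bot])
        (auto simp: filterlim_uminus_at_bot intro!: filterlim_pow_at_top filterlim_ident)
    hence "(k \<longlongrightarrow> 0 - 1 + 1) at_top"
      unfolding k_def by (intro tendsto_intros tendsto_erf_at_top)
    hence "(k \<longlongrightarrow> 0) at_top" by simp
    moreover have "\<forall>\<^sub>F y in at_top. k y \<le> k z"
      using eventually_ge_at_top[of z]
    proof eventually_elim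
      case (elim y)
      show ?case
        by (rule DERIV_nonpos_imp_nonincreasing[OF elim])
          (rule exI, rule conjI, rule der, use False in \<open>simp add: mult_nonneg_nonpos\<close>)
    qed
    ultimately show ?thesis by (rule tendsto_upperbound) simp
  qed
  thus ?thesis by (simp add: k_def)
qed

section \<open>A closed-form solution with initial value 1\<close>

definition robin_exp :: "real \<Rightarrow> real \<Rightarrow> real \<Rightarrow> real" where
  "robin_exp b x t = exp (b\<^sup>2 * t - b * x) * (1 - erf (b * sqrt t - x / (2 * sqrt t)))"

text \<open>The first summand solves the problem with zero boundary value and initial value 1; the
  second corrects the boundary condition. Both \<open>robin_sol\<close> and \<open>robin_exp\<close>
  have the same value at x = 0.\<close>

definition robin_sol :: "real \<Rightarrow> real \<Rightarrow> real \<Rightarrow> real" where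
  "robin_sol b x t = erf (- x / (2 * sqrt t)) + robin_exp b x t"

text \<open>Completing the square leaves a Gaussian without \<open>b\<close>. This simplifies every
  derivative of \<open>robin_exp\<close> and absorbs the growth of its exponential factor.\<close>

lemma exp_complete_square:
  fixes b t x :: real
  assumes "t > 0"
  shows "exp (b\<^sup>2 * t - b * x) * exp (- (b * sqrt t - x / (2 * sqrt t))\<^sup>2) = exp (- (x\<^sup>2 / (4 * t)))"
proof -
  have "(b * sqrt t - x / (2 * sqrt t))\<^sup>2 = b\<^sup>2 * t - b * x + x\<^sup>2 / (4 * t)"
    using assms by (simp add: power2_diff power_mult_distrib power_divide)
  thus ?thesis by (simp add: exp_add[symmetric])
qed

lemma robin_exp_bounds:
  assumes "b > 0" "x \<le> 0" "t > 0"
  shows "0 \<le> robin_exp b x t" "robin_exp b x t \<le> exp (- (x\<^sup>2 / (4 * t)))"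
proof -
  let ?z = "b * sqrt t - x / (2 * sqrt t)"
  have "x / (2 * sqrt t) \<le> 0" using assms by (simp add: divide_nonpos_pos)
  moreover have "0 \<le> b * sqrt t" using assms by simp
  ultimately have z: "?z \<ge> 0" by linarith
  show "0 \<le> robin_exp b x t" unfolding robin_exp_def using erf_le_1[of ?z] by simp
  have "robin_exp b x t \<le> exp (b\<^sup>2 * t - b * x) * exp (- ?z\<^sup>2)"
    unfolding robin_exp_def by (rule mult_left_mono[OF erfc_le_exp[OF z]]) simp
  thus "robin_exp b x t \<le> exp (- (x\<^sup>2 / (4 * t)))"
    using exp_complete_square[of t b x] assms by simp
qed

text \<open>The difference is \<open>robin_exp\<close> minus a complementary error function, and
  both lie between 0 and the Gaussian. The estimate gives boundedness and also the initial value 1,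
  uniformly away from x = 0.\<close>

lemma robin_sol_bounds:
  assumes "b > 0" "x \<le> 0" "t > 0"
  shows "\<bar>robin_sol b x t - 1\<bar> \<le> exp (- (x\<^sup>2 / (4 * t)))"
proof -
  have "0 \<le> - x / (2 * sqrt t)" by (rule divide_nonneg_pos) (use assms in auto)
  from erfc_le_exp[OF this] have "1 - erf (- x / (2 * sqrt t)) \<le> exp (- (x\<^sup>2 / (4 * t)))"
    using assms by (simp add: power_divide power_mult_distrib)
  thus ?thesis unfolding robin_sol_def
    using robin_exp_bounds[OF assms] erf_le_1[of "- x / (2 * sqrt t)"] by linarith
qed

lemma has_real_derivative_exp_erfc:
  assumes "(p has_real_derivative p') (at x within A)" "(q has_real_derivative q') (at x within A)"
  shows "((\<lambda>x. exp (p x) * (1 - erf (q x))) has_real_derivative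
     p' * (exp (p x) * (1 - erf (q x))) - 2 / sqrt pi * (exp (p x) * exp (- (q x)\<^sup>2)) * q') (at x within A)"
  by (rule derivative_eq_intros assms refl)+ (simp add: algebra_simps)

lemma has_real_derivative_robin_exp_x:
  assumes "t > 0"
  shows "((\<lambda>x. robin_exp b x t) has_real_derivative
     - b * robin_exp b x t + exp (- (x\<^sup>2 / (4 * t))) / sqrt (pi * t)) (at x within A)"
proof -
  have p: "((\<lambda>x. b\<^sup>2 * t - b * x) has_real_derivative - b) (at x within A)"
    by (auto intro!: derivative_eq_intros)
  have q: "((\<lambda>x. b * sqrt t - x / (2 * sqrt t)) has_real_derivative - 1 / (2 * sqrt t)) (at x within A)"
    by (rule DERIV_cong[OF DERIV_diff[OF DERIV_const DERIV_cdivide[OF DERIV_ident]]]) simp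
  show ?thesis
    unfolding robin_exp_def
    by (rule DERIV_cong[OF has_real_derivative_exp_erfc[OF p q]])
      (simp only: exp_complete_square[OF assms], simp add: real_sqrt_mult)
qed

lemma has_real_derivative_erf_similarity_x:
  assumes "t > 0"
  shows "((\<lambda>x. erf (- x / (2 * sqrt t))) has_real_derivative
     - exp (- (x\<^sup>2 / (4 * t))) / sqrt (pi * t)) (at x within A)"
proof -
  have q: "((\<lambda>x. - x / (2 * sqrt t)) has_real_derivative - 1 / (2 * sqrt t)) (at x within A)"
    by (rule DERIV_cdivide[OF DERIV_minus[OF DERIV_ident]])
  show ?thesis
    by (rule DERIV_cong[OF has_real_derivative_erf_compose[OF q]])
      (use assms in \<open>simp add: real_sqrt_mult power_divide power_mult_distrib\<close>)
qed

text \<open>The Gaussian terms of the two summands cancel. As \<open>erf 0 = 0\<close>, this is the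
  Robin condition at x = 0.\<close>

lemma has_real_derivative_robin_sol_x:
  assumes "t > 0"
  shows "((\<lambda>x. robin_sol b x t) has_real_derivative - b * robin_exp b x t) (at x within A)"
  unfolding robin_sol_def
  by (rule DERIV_cong[OF DERIV_add[OF has_real_derivative_erf_similarity_x[OF assms]
          has_real_derivative_robin_exp_x[OF assms]]]) simp

lemma has_real_derivative_divide_sqrt:
  assumes "t > 0"
  shows "((\<lambda>t. x / (2 * sqrt t)) has_real_derivative - x / (4 * t * sqrt t)) (at t)"
  by (rule DERIV_cong[OF DERIV_divide[OF DERIV_const DERIV_cmult[OF DERIV_real_sqrt[OF assms]]]])
    (use assms in \<open>simp_all add: divide_simps\<close>)

lemma has_real_derivative_robin_exp_t:
  assumes "t > 0"
  shows "((\<lambda>t. robin_exp b x t) has_real_derivative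
     b\<^sup>2 * robin_exp b x t - exp (- (x\<^sup>2 / (4 * t))) * (b / sqrt (pi * t) + x / (2 * t * sqrt (pi * t)))) (at t)"
proof -
  have p: "((\<lambda>t. b\<^sup>2 * t - b * x) has_real_derivative b\<^sup>2) (at t)"
    by (auto intro!: derivative_eq_intros)
  have q: "((\<lambda>t. b * sqrt t - x / (2 * sqrt t)) has_real_derivative
      b * (1 / (2 * sqrt t)) + x / (4 * t * sqrt t)) (at t)"
    by (rule DERIV_cong[OF DERIV_diff[OF DERIV_cmult[OF DERIV_real_sqrt[OF assms]]
             has_real_derivative_divide_sqrt[OF assms]]])
       (simp add: inverse_eq_divide)
  show ?thesis
    unfolding robin_exp_def
    by (rule DERIV_cong[OF has_real_derivative_exp_erfc[OF p q]])
      (simp only: exp_complete_square[OF assms], simp add: real_sqrt_mult algebra_simps add_divide_distrib)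
qed

text \<open>The terms with a factor x cancel. What remains is the x-derivative of
  \<open>- b * robin_exp b x t\<close>, which is the heat equation for
  \<open>robin_sol\<close>.\<close>

lemma has_real_derivative_robin_sol_t:
  assumes "t > 0"
  shows "((\<lambda>t. robin_sol b x t) has_real_derivative
     b\<^sup>2 * robin_exp b x t - b * exp (- (x\<^sup>2 / (4 * t))) / sqrt (pi * t)) (at t)"
proof -
  have "((\<lambda>t. erf (- x / (2 * sqrt t))) has_real_derivative
     exp (- (x\<^sup>2 / (4 * t))) * (x / (2 * t * sqrt (pi * t)))) (at t)"
    by (rule DERIV_cong[OF has_real_derivative_erf_compose[OF has_real_derivative_divide_sqrt[OF assms]]])
      (use assms in \<open>simp add: real_sqrt_mult power_divide power_mult_distrib ac_simps\<close>)
  from DERIV_add[OF this has_real_derivative_robin_exp_t[OF assms]] show ?thesis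
    unfolding robin_sol_def by (rule DERIV_cong) (simp add: algebra_simps)
qed

lemma continuous_on_robin_sol:
  "continuous_on (UNIV \<times> {0<..}) (\<lambda>(x, t). robin_sol b x t)"
  unfolding robin_sol_def robin_exp_def case_prod_unfold
  by (intro continuous_intros) auto

section \<open>Uniqueness of the bounded solution\<close>

lemma robin_heat_solution_boundary_value:
  assumes b: "b > 0" and w: "bounded_robin_heat_solution b c w" and "t > 0"
  shows "w 0 t = - c * robin_exp b 0 t"
proof -
  note w' = w[unfolded bounded_robin_heat_solution_def]
  have bdd: "bounded ((\<lambda>(x, t). w x t) ` ({..<0} \<times> {0<..}))"
    by (rule w'[THEN conjunct1])
  have cont: "continuous_on ({..0} \<times> {0..} - {(0, 0)}) (\<lambda>(x, t). w x t)"
    by (rule w'[THEN conjunct2, THEN conjunct1])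
  have w0: "w x 0 = - c" if "x < 0" for x
    using w'[THEN conjunct2, THEN conjunct2, THEN conjunct2] that by blast
  obtain wx wxx wt where
    wx': "\<forall>x\<le>0. \<forall>t>0. ((\<lambda>y. w y t) has_real_derivative wx x t) (at x within {..0})" and
    wxx': "\<forall>x<0. \<forall>t>0. ((\<lambda>y. wx y t) has_real_derivative wxx x t) (at x)" and
    wt': "\<forall>x<0. \<forall>t>0. ((\<lambda>s. w x s) has_real_derivative wt x t) (at t)" and
    heat': "\<forall>x<0. \<forall>t>0. wt x t - wxx x t = 0" and
    bc': "\<forall>t>0. wx 0 t + b * w 0 t = 0"
    using w'[THEN conjunct2, THEN conjunct2, THEN conjunct1]
    by (elim exE conjE) (rule that; assumption)
  note wx = wx'[rule_format] and wxx = wxx'[rule_format] and wt = wt'[rule_format]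
    and heat = heat'[rule_format] and bc = bc'[rule_format]
  obtain B where B: "\<And>x t. x < 0 \<Longrightarrow> t > 0 \<Longrightarrow> \<bar>w x t\<bar> \<le> B"
    using bdd unfolding bounded_iff by fastforce
  \<comment> \<open>Boundedness is given on the open half line only; the one-sided derivative makes
    \<open>w\<close> continuous at the boundary, so the bound passes to the limit.\<close>
  have B': "\<bar>w x t\<bar> \<le> B" if "x \<le> 0" "t > 0" for x t
  proof (cases "x = 0")
    case True
    have "continuous (at 0 within {..<0}) (\<lambda>y. w y t)"
      by (rule DERIV_continuous[OF DERIV_subset[OF wx]]) (use that in auto)
    hence "((\<lambda>y. w y t) \<longlongrightarrow> w 0 t) (at_left 0)"
      by (simp add: continuous_within)
    from tendsto_upperbound[OF tendsto_rabs[OF this]] show ?thesis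
      using True that by (auto simp: eventually_at_filter B)
  qed (use that B in auto)
  \<comment> \<open>The sum has zero initial data and satisfies the homogeneous Robin condition.
    Comparison for both signs of \<sigma> makes it vanish. By the heat equation \<open>wt\<close>
    may stand for \<open>wxx\<close>, so one function serves as both derivatives.\<close>
  have le0: "\<sigma> * (w 0 t + c * robin_sol b 0 t) \<le> 0" if \<sigma>: "\<bar>\<sigma>\<bar> = 1" for \<sigma> :: real
  proof (rule robin_comparison[where M = "B + 2 * \<bar>c\<bar>"
      and v = "\<lambda>x t. \<sigma> * (w x t + c * robin_sol b x t)"
      and vx = "\<lambda>x t. \<sigma> * (wx x t - c * (b * robin_exp b x t))"
      and vxx = "\<lambda>x t. \<sigma> * (wt x t + c * (b\<^sup>2 * robin_exp b x t - b * exp (- (x\<^sup>2 / (4 * t))) / sqrt (pi * t)))"])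
    have "continuous_on ({..0} \<times> {0<..}) (\<lambda>(x, t). w x t)"
      by (rule continuous_on_subset[OF cont]) auto
    moreover have "continuous_on ({..0} \<times> {0<..}) (\<lambda>(x, t). robin_sol b x t)"
      by (rule continuous_on_subset[OF continuous_on_robin_sol]) auto
    ultimately show "continuous_on ({..0} \<times> {0<..}) (\<lambda>(x, t). \<sigma> * (w x t + c * robin_sol b x t))"
      unfolding case_prod_unfold by (intro continuous_intros)
  next
    fix x r :: real assume *: "x \<le> 0" "r > 0"
    have "\<bar>robin_sol b x r - 1\<bar> \<le> exp (- (x\<^sup>2 / (4 * r)))"
      by (rule robin_sol_bounds[OF b *])
    also have "\<dots> \<le> 1" using * by simp
    finally have "\<bar>robin_sol b x r\<bar> \<le> 2" by linarith
    hence "\<bar>c * robin_sol b x r\<bar> \<le> 2 * \<bar>c\<bar>"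
      using mult_left_mono[of "\<bar>robin_sol b x r\<bar>" 2 "\<bar>c\<bar>"] by (simp add: abs_mult)
    hence "\<bar>w x r + c * robin_sol b x r\<bar> \<le> B + 2 * \<bar>c\<bar>"
      using B'[OF *] by linarith
    hence "\<bar>\<sigma> * (w x r + c * robin_sol b x r)\<bar> \<le> B + 2 * \<bar>c\<bar>"
      using \<sigma> by (simp add: abs_mult)
    thus "\<sigma> * (w x r + c * robin_sol b x r) \<le> B + 2 * \<bar>c\<bar>" by linarith
    show "((\<lambda>y. \<sigma> * (w y r + c * robin_sol b y r)) has_real_derivative
        \<sigma> * (wx x r - c * (b * robin_exp b x r))) (at x within {..0})"
      by (rule DERIV_cong[OF DERIV_cmult[OF DERIV_add[OF wx[OF *]
              DERIV_cmult[OF has_real_derivative_robin_sol_x[OF *(2)]]]]]) simp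
  next
    fix x r :: real assume *: "x < 0" "r > 0"
    show "((\<lambda>y. \<sigma> * (wx y r - c * (b * robin_exp b y r))) has_real_derivative
      \<sigma> * (wt x r + c * (b\<^sup>2 * robin_exp b x r - b * exp (- (x\<^sup>2 / (4 * r))) / sqrt (pi * r)))) (at x)"
      by (rule DERIV_cong[OF DERIV_cmult[OF DERIV_diff[OF wxx[OF *]
              DERIV_cmult[OF DERIV_cmult[OF has_real_derivative_robin_exp_x[OF *(2)]]]]]])
        (use heat[OF *] in \<open>simp add: algebra_simps power2_eq_square\<close>)
    show "((\<lambda>r. \<sigma> * (w x r + c * robin_sol b x r)) has_real_derivative
      \<sigma> * (wt x r + c * (b\<^sup>2 * robin_exp b x r - b * exp (- (x\<^sup>2 / (4 * r))) / sqrt (pi * r)))) (at r)"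
      by (rule DERIV_cmult[OF DERIV_add[OF wt[OF *]
              DERIV_cmult[OF has_real_derivative_robin_sol_t[OF *(2)]]]])
  next
    fix r :: real assume "r > 0"
    from bc[OF this] show "\<sigma> * (wx 0 r - c * (b * robin_exp b 0 r)) +
        b * (\<sigma> * (w 0 r + c * robin_sol b 0 r)) = 0"
      by (simp add: robin_sol_def add_eq_0_iff algebra_simps)
  next
    fix R \<delta> \<eta> :: real assume \<delta>: "0 < \<delta>" and \<eta>: "0 < \<eta>"
    \<comment> \<open>The compact set stays away from the corner, so \<open>w\<close> is close to
      its initial value \<open>- c\<close> uniformly in x for small times.\<close>
    have "uniformly_continuous_on ({- R..- \<delta>} \<times> {0..1}) (\<lambda>(x, t). w x t)"
      by (rule compact_uniformly_continuous[OF continuous_on_subset[OF cont]])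
        (use \<delta> in \<open>auto simp: compact_Times\<close>)
    with \<eta> obtain d where d: "d > 0" "\<And>p q. p \<in> {- R..- \<delta>} \<times> {0..1} \<Longrightarrow>
        q \<in> {- R..- \<delta>} \<times> {0..1} \<Longrightarrow> dist q p < d \<Longrightarrow>
        dist ((\<lambda>(x, t). w x t) q) ((\<lambda>(x, t). w x t) p) < \<eta> / 2"
      unfolding uniformly_continuous_on_def by (metis half_gt_zero)
    \<comment> \<open>The bounds keep the times in the compact set, within the modulus of
      continuity, and small enough that the Gaussian error costs at most half of \<eta>. Adding 1 to
      \<open>\<bar>c\<bar>\<close> avoids a zero denominator.\<close>
    define e where "e = Min {1, d / 2, \<eta> * \<delta>\<^sup>2 / (8 * (\<bar>c\<bar> + 1))}"
    have epos: "e > 0" using d(1) \<eta> \<delta> by (auto simp: e_def intro!: divide_pos_pos mult_pos_pos)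
    have "e \<le> 1" "e \<le> d / 2" "e \<le> \<eta> * \<delta>\<^sup>2 / (8 * (\<bar>c\<bar> + 1))"
      unfolding e_def by (rule Min_le; simp)+
    with d(1) have ele: "e \<le> 1" "e < d" "e \<le> \<eta> * \<delta>\<^sup>2 / (8 * (\<bar>c\<bar> + 1))"
      by auto
    show "\<exists>\<epsilon>>0. \<forall>r\<in>{0<..\<epsilon>}. \<forall>x\<in>{- R..- \<delta>}. \<sigma> * (w x r + c * robin_sol b x r) \<le> \<eta>"
    proof (intro exI[of _ e] conjI ballI epos)
      fix r x :: real assume r: "r \<in> {0<..e}" and x: "x \<in> {- R..- \<delta>}"
      have x0: "x < 0" "\<delta> \<le> \<bar>x\<bar>" using x \<delta> by auto
      have r0: "0 < r" "r \<le> e" using r by auto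
      have "dist (w x r) (w x 0) < \<eta> / 2"
        using d(2)[of "(x, 0)" "(x, r)"] x r0 ele by (auto simp: dist_Pair_Pair)
      hence 1: "\<bar>w x r + c\<bar> \<le> \<eta> / 2" by (simp add: w0[OF x0(1)] dist_real_def)
      have "\<delta>\<^sup>2 \<le> x\<^sup>2" using x0 \<delta> by (simp add: abs_le_square_iff[symmetric])
      hence u: "\<delta>\<^sup>2 / (4 * r) \<le> x\<^sup>2 / (4 * r)" using r0 by (simp add: divide_right_mono)
      have "\<bar>robin_sol b x r - 1\<bar> \<le> exp (- (x\<^sup>2 / (4 * r)))"
        by (rule robin_sol_bounds) (use b x0 r0 in auto)
      \<comment> \<open>From \<open>u \<le> exp u\<close> follows
        \<open>exp (- u) \<le> 1 / u\<close> for positive u, which makes the Gaussian linear in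
        \<open>r\<close>.\<close>
      also have "\<dots> \<le> 4 * r / \<delta>\<^sup>2"
      proof -
        have "\<delta>\<^sup>2 / (4 * r) \<le> exp (x\<^sup>2 / (4 * r))"
          using u exp_ge_add_one_self[of "x\<^sup>2 / (4 * r)"] by linarith
        hence "1 / exp (x\<^sup>2 / (4 * r)) \<le> 1 / (\<delta>\<^sup>2 / (4 * r))"
          using \<delta> r0 by (intro divide_left_mono) auto
        thus ?thesis by (simp add: exp_minus inverse_eq_divide)
      qed
      finally have "\<bar>c * (robin_sol b x r - 1)\<bar> \<le> (\<bar>c\<bar> + 1) * (4 * r / \<delta>\<^sup>2)"
        unfolding abs_mult by (intro mult_mono) auto
      also have "\<dots> \<le> \<eta> / 2"
      proof -
        have "r \<le> \<eta> * \<delta>\<^sup>2 / (8 * (\<bar>c\<bar> + 1))" using r0 ele by linarith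
        thus ?thesis using \<delta> by (simp add: field_simps add_nonneg_pos)
      qed
      finally have 2: "\<bar>c * (robin_sol b x r - 1)\<bar> \<le> \<eta> / 2" .
      have "\<bar>w x r + c * robin_sol b x r\<bar> \<le> \<eta>"
        using 1 2 unfolding right_diff_distrib by linarith
      hence "\<bar>\<sigma> * (w x r + c * robin_sol b x r)\<bar> \<le> \<eta>"
        using \<sigma> by (simp add: abs_mult)
      thus "\<sigma> * (w x r + c * robin_sol b x r) \<le> \<eta>" by linarith
    qed
  qed (use b \<open>t > 0\<close> in auto)
  from le0[of 1] le0[of "- 1"] have "w 0 t + c * robin_sol b 0 t = 0" by simp
  thus ?thesis by (simp add: robin_sol_def)
qed

section \<open>Half integrals\<close>

text \<open>The integrand may be singular at both ends. Being nonnegative, it is integrable once the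
  antiderivative has finite limits there, and continuity of \<open>F\<close> supplies these.\<close>

lemma has_bochner_integral_FTC_open:
  fixes f F :: "real \<Rightarrow> real"
  assumes "a < b" "continuous_on {a..b} F"
    and "\<And>x. a < x \<Longrightarrow> x < b \<Longrightarrow> (F has_real_derivative f x) (at x)"
    and "\<And>x. a < x \<Longrightarrow> x < b \<Longrightarrow> isCont f x"
    and "\<And>x. a < x \<Longrightarrow> x < b \<Longrightarrow> 0 \<le> f x"
  shows "has_bochner_integral lborel (\<lambda>x. indicator {a<..<b} x * f x) (F b - F a)"
proof -
  have lim: "((F \<circ> real_of_ereal) \<longlongrightarrow> F a) (at_right (ereal a))"
    "((F \<circ> real_of_ereal) \<longlongrightarrow> F b) (at_left (ereal b))"
    using assms(1,2) by (auto simp: ereal_tendsto_simps continuous_on_Icc_at_rightD continuous_on_Icc_at_leftD)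
  have "set_integrable lborel (einterval a b) f" "(LBINT x=a..b. f x) = F b - F a"
    by (rule interval_integral_FTC_nonneg[OF _ _ _ _ lim]; use assms in auto)+
  thus ?thesis
    using assms(1) by (simp add: has_bochner_integral_iff set_integrable_def
        interval_lebesgue_integral_def set_lebesgue_integral_def)
qed

lemma f0_half_eq: "0 < u \<Longrightarrow> f0_half u = 1 / sqrt (pi * u)"
  by (simp add: f0_half_def Gamma_one_half_real powr_minus_divide powr_half_sqrt real_sqrt_mult)

text \<open>This is the Beta integral B(1/2, 1/2) = pi, the semigroup property of the kernel. An
  affine map of the interval onto [-1, 1] followed by \<open>arcsin\<close> gives an antiderivative
  whose total increase is pi.\<close>

lemma has_bochner_integral_f0_half_convolution:
  assumes "q < t"
  shows "has_bochner_integral lborel (\<lambda>s. indicator {q<..<t} s * (f0_half (t - s) * f0_half (s - q))) 1"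
proof -
  define F where "F s = arcsin ((2 * s - q - t) / (t - q)) / pi" for s
  have "has_bochner_integral lborel (\<lambda>s. indicator {q<..<t} s * (1 / (pi * sqrt ((t - s) * (s - q))))) (F t - F q)"
  proof (rule has_bochner_integral_FTC_open[OF assms])
    show "continuous_on {q..t} F" unfolding F_def
      by (intro continuous_intros) (use assms in \<open>auto simp: field_simps\<close>)
  next
    fix s assume s: "q < s" "s < t"
    have l: "- 1 < (2 * s - q - t) / (t - q)" "(2 * s - q - t) / (t - q) < 1"
      using s assms by (auto simp: field_simps)
    have d: "((\<lambda>s. (2 * s - q - t) / (t - q)) has_real_derivative 2 / (t - q)) (at s)"
      by (rule DERIV_cdivide) (auto intro!: derivative_eq_intros)
    have "(t - q)\<^sup>2 - (2 * s - q - t)\<^sup>2 = 2\<^sup>2 * ((t - s) * (s - q))"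
      by (simp add: power2_eq_square algebra_simps)
    moreover have "1 - ((2 * s - q - t) / (t - q))\<^sup>2 = ((t - q)\<^sup>2 - (2 * s - q - t)\<^sup>2) / (t - q)\<^sup>2"
      using assms by (subst power_divide) (simp add: diff_divide_distrib)
    ultimately have "1 - ((2 * s - q - t) / (t - q))\<^sup>2 = (2 / (t - q))\<^sup>2 * ((t - s) * (s - q))"
      by (simp add: power_divide)
    hence "sqrt (1 - ((2 * s - q - t) / (t - q))\<^sup>2) = 2 / (t - q) * sqrt ((t - s) * (s - q))"
      using assms by (simp add: real_sqrt_mult)
    with DERIV_cdivide[OF DERIV_chain2[OF DERIV_arcsin[OF l] d], of pi]
    show "(F has_real_derivative 1 / (pi * sqrt ((t - s) * (s - q)))) (at s)"
      unfolding F_def by (rule_tac DERIV_cong) (use assms in \<open>auto simp: field_simps\<close>)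
    show "isCont (\<lambda>s. 1 / (pi * sqrt ((t - s) * (s - q)))) s"
      by (intro continuous_intros) (use s in auto)
    show "0 \<le> 1 / (pi * sqrt ((t - s) * (s - q)))" using s by simp
  qed
  moreover have "F t - F q = 1"
  proof -
    have "(2 * t - q - t) / (t - q) = 1" "(2 * q - q - t) / (t - q) = - 1"
      using assms by (auto simp: field_simps)
    thus ?thesis by (simp add: F_def)
  qed
  moreover have "indicator {q<..<t} s * (1 / (pi * sqrt ((t - s) * (s - q)))) =
      indicator {q<..<t} s * (f0_half (t - s) * f0_half (s - q))" for s
    by (auto simp: f0_half_eq real_sqrt_mult indicator_def)
  ultimately show ?thesis by simp
qed

text \<open>The substitution \<open>u = b * sqrt (t - s)\<close> removes the singularity and turns
  the integrand into a Gaussian, hence the antiderivative with \<open>erf\<close>.\<close>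

lemma has_bochner_integral_f0_half_exp:
  assumes "b > 0" "t > 0"
  shows "has_bochner_integral lborel (\<lambda>s. indicator {0<..<t} s * (f0_half (t - s) * exp (b\<^sup>2 * s)))
     (exp (b\<^sup>2 * t) * erf (b * sqrt t) / b)"
proof -
  define F where "F s = - (exp (b\<^sup>2 * t) * erf (b * sqrt (t - s)) / b)" for s
  have "has_bochner_integral lborel (\<lambda>s. indicator {0<..<t} s * (exp (b\<^sup>2 * s) / sqrt (pi * (t - s)))) (F t - F 0)"
  proof (rule has_bochner_integral_FTC_open[OF assms(2)])
    show "continuous_on {0..t} F" unfolding F_def
      by (intro continuous_intros) (use assms in auto)
  next
    fix s assume s: "0 < s" "s < t"
    have d: "((\<lambda>s. sqrt (t - s)) has_real_derivative inverse (sqrt (t - s)) / 2 * (0 - 1)) (at s)"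
      by (rule DERIV_chain2[OF DERIV_real_sqrt DERIV_diff[OF DERIV_const DERIV_ident]]) (use s in simp)
    have "exp (b\<^sup>2 * t) * exp (- (b * sqrt (t - s))\<^sup>2) = exp (b\<^sup>2 * s)"
      using s by (simp add: exp_add[symmetric] power_mult_distrib algebra_simps)
    thus "(F has_real_derivative exp (b\<^sup>2 * s) / sqrt (pi * (t - s))) (at s)"
      unfolding F_def
      by (intro DERIV_cong[OF DERIV_minus[OF DERIV_cdivide[OF DERIV_cmult[OF
              DERIV_chain2[OF has_real_derivative_erf DERIV_cmult[OF d]]]]]])
        (use assms in \<open>simp add: real_sqrt_mult divide_simps\<close>)
    show "isCont (\<lambda>s. exp (b\<^sup>2 * s) / sqrt (pi * (t - s))) s"
      by (intro continuous_intros) (use s in auto)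
    show "0 \<le> exp (b\<^sup>2 * s) / sqrt (pi * (t - s))" using s by simp
  qed
  moreover have "F t - F 0 = exp (b\<^sup>2 * t) * erf (b * sqrt t) / b" by (simp add: F_def)
  moreover have "indicator {0<..<t} s * (exp (b\<^sup>2 * s) / sqrt (pi * (t - s))) =
      indicator {0<..<t} s * (f0_half (t - s) * exp (b\<^sup>2 * s))" for s
    by (auto simp: f0_half_eq indicator_def)
  ultimately show ?thesis by simp
qed

lemma f0_half_nonneg: "0 \<le> f0_half u"
  by (simp add: f0_half_def Gamma_one_half_real)

lemma borel_measurable_f0_half [measurable]: "f0_half \<in> borel_measurable borel"
  unfolding f0_half_def[abs_def] by measurable

lemma borel_measurable_erf [measurable]: "erf \<in> borel_measurable borel"
  by (intro borel_measurable_continuous_onI continuous_on_erf continuous_on_id)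

text \<open>The half integral of the exponential is itself a half integral, so Fubini's theorem and
  the semigroup property of the kernel apply.\<close>
lemma has_bochner_integral_f0_half_exp_erf:
  assumes "b > 0" "t > 0"
  shows "has_bochner_integral lborel
    (\<lambda>s. indicator {0<..<t} s * (f0_half (t - s) * (exp (b\<^sup>2 * s) * erf (b * sqrt s) / b)))
    ((exp (b\<^sup>2 * t) - 1) / b\<^sup>2)"
proof (rule has_bochner_integral_nn_integral)
  \<comment> \<open>Extending by 0 outside the triangle 0 < q < s < t lets both iterated integrals
    run over the whole line. As \<open>G\<close> is nonnegative, they may be exchanged before
    integrability is known.\<close>
  define G where "G s q = (if 0 < q \<and> q < s \<and> s < t
      then f0_half (t - s) * f0_half (s - q) * exp (b\<^sup>2 * q) else 0)" for s q
  have G_nonneg: "0 \<le> G s q" for s q by (simp add: G_def f0_half_nonneg)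
  have Gs: "(\<integral>\<^sup>+q. G s q \<partial>lborel) =
      ennreal (indicator {0<..<t} s * (f0_half (t - s) * (exp (b\<^sup>2 * s) * erf (b * sqrt s) / b)))" for s
  proof (cases "0 < s \<and> s < t")
    case True
    have "G s = (\<lambda>q. f0_half (t - s) * (indicator {0<..<s} q * (f0_half (s - q) * exp (b\<^sup>2 * q))))"
      using True by (auto simp: G_def fun_eq_iff indicator_def)
    with has_bochner_integral_mult_right[OF has_bochner_integral_f0_half_exp[OF assms(1), of s], of "f0_half (t - s)"]
    have "has_bochner_integral lborel (G s) (f0_half (t - s) * (exp (b\<^sup>2 * s) * erf (b * sqrt s) / b))"
      using True by simp
    thus ?thesis
      using True by (simp add: has_bochner_integral_iff nn_integral_eq_integral G_nonneg)
  next
    case False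
    hence "G s q = 0" for q by (auto simp: G_def)
    with False show ?thesis by auto
  qed
  \<comment> \<open>In this order the two kernels convolve to 1, and only the exponential is
    left.\<close>
  have Gq: "(\<integral>\<^sup>+s. G s q \<partial>lborel) = ennreal (indicator {0<..<t} q * exp (b\<^sup>2 * q))" for q
  proof (cases "0 < q \<and> q < t")
    case True
    have "(\<lambda>s. G s q) = (\<lambda>s. exp (b\<^sup>2 * q) * (indicator {q<..<t} s * (f0_half (t - s) * f0_half (s - q))))"
      using True by (auto simp: G_def fun_eq_iff indicator_def)
    with has_bochner_integral_mult_right[OF has_bochner_integral_f0_half_convolution[of q t], of "exp (b\<^sup>2 * q)"]
    have "has_bochner_integral lborel (\<lambda>s. G s q) (exp (b\<^sup>2 * q))"
      using True by simp
    thus ?thesis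
      using True by (simp add: has_bochner_integral_iff nn_integral_eq_integral G_nonneg)
  next
    case False
    hence "G s q = 0" for s by (auto simp: G_def)
    with False show ?thesis by auto
  qed
  have "has_bochner_integral lborel (\<lambda>q. indicator {0<..<t} q * exp (b\<^sup>2 * q))
      (exp (b\<^sup>2 * t) / b\<^sup>2 - exp (b\<^sup>2 * 0) / b\<^sup>2)"
  proof (rule has_bochner_integral_FTC_open[OF assms(2)])
    fix x :: real
    show "((\<lambda>q. exp (b\<^sup>2 * q) / b\<^sup>2) has_real_derivative exp (b\<^sup>2 * x)) (at x)"
      by (rule DERIV_cong[OF DERIV_cdivide[OF DERIV_chain2[OF DERIV_exp DERIV_cmult[OF DERIV_ident]]]])
        (use assms in simp)
  qed (use assms in \<open>auto intro!: continuous_intros\<close>)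
  hence exp: "(\<integral>\<^sup>+q. ennreal (indicator {0<..<t} q * exp (b\<^sup>2 * q)) \<partial>lborel) = ennreal ((exp (b\<^sup>2 * t) - 1) / b\<^sup>2)"
    by (simp add: has_bochner_integral_iff nn_integral_eq_integral diff_divide_distrib)
  have "(\<lambda>(s, q). ennreal (G s q)) \<in> borel_measurable (lborel \<Otimes>\<^sub>M lborel)"
    unfolding G_def by measurable
  from lborel_pair.Fubini'[OF this] show "(\<integral>\<^sup>+s. ennreal (indicator {0<..<t} s *
      (f0_half (t - s) * (exp (b\<^sup>2 * s) * erf (b * sqrt s) / b))) \<partial>lborel) = ennreal ((exp (b\<^sup>2 * t) - 1) / b\<^sup>2)"
    by (simp only: Gs Gq exp)
  have "0 \<le> erf z" if "0 \<le> z" for z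
    using erf_mono[OF that] by simp
  thus "AE s in lborel. 0 \<le> indicator {0<..<t} s * (f0_half (t - s) * (exp (b\<^sup>2 * s) * erf (b * sqrt s) / b))"
    using assms by (auto simp: indicator_def f0_half_nonneg)
qed (use assms in auto)

section \<open>The Caputo half derivative of the boundary value\<close>

theorem corollary1p3:
  fixes b c :: real and w :: "real \<Rightarrow> real \<Rightarrow> real" and \<xi> :: "real \<Rightarrow> real"
  assumes "b > 0"
    and "bounded_robin_heat_solution b c w"
    and "\<And>t. t > 0 \<Longrightarrow> \<xi> t = w 0 t"
  shows "\<forall>t>0. caputo_half_exists \<xi> t \<and> caputo_half \<xi> t = - b * \<xi> t"
proof (intro allI impI)
  fix t :: real assume t: "t > 0"
  have \<xi>: "\<xi> s = - c * robin_exp b 0 s" if "s > 0" for s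
    using robin_heat_solution_boundary_value[OF assms(1,2) that] assms(3)[OF that] by simp
  \<comment> \<open>The formula for \<xi> is known for positive times only, so the derivative is
    transferred on the open half line. At x = 0 the Gaussian is 1, and its coefficient becomes
    \<open>b * f0_half s\<close>.\<close>
  have der: "(\<xi> has_real_derivative - c * (b\<^sup>2 * robin_exp b 0 s - b * f0_half s)) (at s)" if "s > 0" for s
  proof (rule has_field_derivative_transform_within_open[where S = "{0<..}"])
    show "((\<lambda>s. - c * robin_exp b 0 s) has_real_derivative
        - c * (b\<^sup>2 * robin_exp b 0 s - b * f0_half s)) (at s)"
      by (rule DERIV_cong[OF DERIV_cmult[OF has_real_derivative_robin_exp_t[OF that]]])
        (use that in \<open>simp add: f0_half_eq\<close>)
  qed (use that \<xi> in auto)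
  let ?I = "\<lambda>s. indicator {0<..<t} s :: real"
  \<comment> \<open>Splitting \<open>1 - erf\<close> gives three known half integrals. The power
    \<open>b ^ 3\<close> offsets the division by \<open>b\<close> in the second, and
    \<open>s - 0\<close> is the convolution with \<open>q = 0\<close>.\<close>
  have "has_bochner_integral lborel
      (\<lambda>s. - c * b\<^sup>2 * (?I s * (f0_half (t - s) * exp (b\<^sup>2 * s)))
        + c * b ^ 3 * (?I s * (f0_half (t - s) * (exp (b\<^sup>2 * s) * erf (b * sqrt s) / b)))
        + c * b * (?I s * (f0_half (t - s) * f0_half (s - 0))))
      (- c * b\<^sup>2 * (exp (b\<^sup>2 * t) * erf (b * sqrt t) / b) + c * b ^ 3 * ((exp (b\<^sup>2 * t) - 1) / b\<^sup>2)
        + c * b * 1)"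
    by (intro has_bochner_integral_add has_bochner_integral_mult_right
        has_bochner_integral_f0_half_exp has_bochner_integral_f0_half_exp_erf
        has_bochner_integral_f0_half_convolution assms(1) t)
  moreover have "- c * b\<^sup>2 * (?I s * (f0_half (t - s) * exp (b\<^sup>2 * s)))
        + c * b ^ 3 * (?I s * (f0_half (t - s) * (exp (b\<^sup>2 * s) * erf (b * sqrt s) / b)))
        + c * b * (?I s * (f0_half (t - s) * f0_half (s - 0)))
      = ?I s * (f0_half (t - s) * deriv \<xi> s)" for s
  proof (cases "0 < s \<and> s < t")
    case True
    hence d: "deriv \<xi> s = - c * (b\<^sup>2 * robin_exp b 0 s - b * f0_half s)"
      using DERIV_imp_deriv[OF der[of s]] by simp
    show ?thesis
      unfolding d using assms(1) True
      by (simp add: robin_exp_def power2_eq_square power3_eq_cube algebra_simps)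
  qed auto
  \<comment> \<open>The -1 in the second value cancels the 1 from the convolution.\<close>
  moreover have "- c * b\<^sup>2 * (exp (b\<^sup>2 * t) * erf (b * sqrt t) / b)
        + c * b ^ 3 * ((exp (b\<^sup>2 * t) - 1) / b\<^sup>2) + c * b * 1 = - b * \<xi> t"
  proof -
    have "c * b ^ 3 * ((exp (b\<^sup>2 * t) - 1) / b\<^sup>2) = c * b * (exp (b\<^sup>2 * t) - 1)"
      using assms(1) by (simp add: power2_eq_square power3_eq_cube)
    thus ?thesis
      using assms(1) by (simp add: \<xi>[OF t] robin_exp_def power2_eq_square algebra_simps)
  qed
  \<comment> \<open>This yields integrability together with the value, so the default value 0 of the
    integral does not interfere.\<close>
  ultimately have "has_bochner_integral lborel (\<lambda>s. ?I s * (f0_half (t - s) * deriv \<xi> s)) (- b * \<xi> t)"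
    by simp
  moreover have "\<xi> differentiable (at s)" if "s \<in> {0<..<t}" for s
    using der[of s] that by (auto simp: real_differentiable_def)
  ultimately show "caputo_half_exists \<xi> t \<and> caputo_half \<xi> t = - b * \<xi> t"
    by (auto simp: caputo_half_exists_def caputo_half_def set_integrable_def
        set_lebesgue_integral_def has_bochner_integral_iff)
qed

end
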